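(* (Charger adjacent to transmitter, noiseless channel, as a Markov decision process.) In the setting of the context, assume the set $\mathcal B$ of reachable battery states is finite. For $\rho\ge0$ let $$J_X(\rho)=\sup_{\substack{\{p(x_t|x^{t-1}),\,e_t(x^{t-1})\}_{t=1}^\infty:\\(\mathbf X,\mathbf E)\in\mathcal A'_\infty\text{ a.s.}}}\liminf_{n\to\infty}\frac1n\Big(H(X^n)-\rho\sum_{t=1}^n\mathbb E[E_t]\Big),$$ the supremum being over $\mathcal X$-valued processes $\mathbf X$ and functions $e_t:\mathcal X^{t-1}\to\mathcal E$, with $E_t=e_t(X^{t-1})$. Then $J_X(\rho)$ equals the optimal infinite-horizon expected average reward $$\sup_\pi\liminf_{n\to\infty}\frac1n\sum_{t=1}^n\mathbb E[g(u_t)]$$ of the Markov decision process with: state $b_t\in\mathcal B$, initial state $b_1=\bar B$; action $u_t=(e_t,p_t)$ consisting of $e_t\in\mathcal E$ and a probability distribution $p_t$ on $\mathcal X$, constrained to $\mathcal U(b_t)$ where $\mathcal U(b)=\{(e,p):\ \phi(X)\le\min\{b+e,\bar B\}\text{ a.s. for }X\sim p\}$; disturbance $x_t\in\mathcal X$ drawn from $p_t$; state dynamics $b_{t+1}=\min\{b_t+e_t,\bar B\}-\phi(x_t)$; and reward $g(e,p)=H(p)-\rho e$. Here $\pi=\{\mu_1,\mu_2,\dots\}$ ranges over all policies, $\mu_t$ mapping the history $x^{t-1}$ of disturbances to an action $u_t=\mu_t(x^{t-1})\in\mathcal U(b_t)$.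
   Context: $\mathcal X$ and $\mathcal E$ are finite; $\phi:\mathcal X\to[0,\infty)$; $\bar B$ is the battery capacity; $\mathcal E\subseteq[0,\bar B]$ contains a strictly positive element; $\phi(x)\le\bar B$ for all $x\in\mathcal X$; there is $0\in\mathcal X$ with $\phi(0)=0$. $H$ is Shannon entropy (of a random variable or of a distribution), logarithms to base 2. $\mathcal A'_n$ is the set of pairs $(x^n,e^n)\in\mathcal X^n\times\mathcal E^n$ such that, with $b_1=\bar B$ and $b_{t+1}=\min\{b_t+e_t,\bar B\}-\phi(x_t)$, one has $\phi(x_t)\le\min\{b_t+e_t,\bar B\}$ for $t=1,\dots,n$. For infinite sequences, $(\mathbf x,\mathbf e)\in\mathcal A'_\infty$ means $(x^n,e^n)\in\mathcal A'_n$ for every $n\ge1$. $\mathcal B$ is the set of all battery levels that can be reached from $b_1=\bar B$ by some finite feasible pair $(x^n,e^n)\in\mathcal A'_n$. *)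

theory Defs
  imports "HOL-Probability.Probability"
begin

text \<open>
  Time is counted from 0: index \<open>t\<close> of a sequence holds the entry for time \<open>t + 1\<close>, so
  \<open>battery _ _ _ _ t\<close> is \<open>b_(t+1)\<close>. A finite word \<open>x^n\<close> is a list of length \<open>n\<close>, and a family
  of functions on \<open>X^(t-1)\<close>, \<open>t = 1, 2, \<dots>\<close>, is one function on lists.
\<close>

section \<open>The battery\<close>

definition battery_step :: "('x \<Rightarrow> real) \<Rightarrow> real \<Rightarrow> real \<Rightarrow> real \<Rightarrow> 'x \<Rightarrow> real" where
  "battery_step \<phi> B b e x = min (b + e) B - \<phi> x"

primrec battery ::
  "('x \<Rightarrow> real) \<Rightarrow> real \<Rightarrow> (nat \<Rightarrow> 'x) \<Rightarrow> (nat \<Rightarrow> real) \<Rightarrow> nat \<Rightarrow> real" where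
  "battery \<phi> B x e 0 = B"
| "battery \<phi> B x e (Suc t) = battery_step \<phi> B (battery \<phi> B x e t) (e t) (x t)"

definition feasible_words ::
  "('x \<Rightarrow> real) \<Rightarrow> real \<Rightarrow> real set \<Rightarrow> nat \<Rightarrow> ('x list \<times> real list) set" where
  "feasible_words \<phi> B E n =
     {(xs, es). length xs = n \<and> length es = n \<and> set es \<subseteq> E \<and>
        (\<forall>t<n. \<phi> (xs ! t) \<le> min (battery \<phi> B (nth xs) (nth es) t + es ! t) B)}"

definition feasible_seqs ::
  "('x \<Rightarrow> real) \<Rightarrow> real \<Rightarrow> real set \<Rightarrow> ((nat \<Rightarrow> 'x) \<times> (nat \<Rightarrow> real)) set" where
  "feasible_seqs \<phi> B E =
     {(x, e). \<forall>n\<ge>1. (map x [0..<n], map e [0..<n]) \<in> feasible_words \<phi> B E n}"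

definition reachable :: "('x \<Rightarrow> real) \<Rightarrow> real \<Rightarrow> real set \<Rightarrow> real set" where
  "reachable \<phi> B E =
     {battery \<phi> B (nth xs) (nth es) n | xs es n. (xs, es) \<in> feasible_words \<phi> B E n}"

section \<open>Entropy\<close>

text \<open>This is \<open>information_space.entropy_Pow\<close> at base 2, usable outside the locale.\<close>

definition shannon_entropy :: "'a measure \<Rightarrow> ('a \<Rightarrow> 'b) \<Rightarrow> real" where
  "shannon_entropy M X = prob_space.entropy M 2 (count_space (X ` space M)) X"

definition pmf_entropy :: "'x pmf \<Rightarrow> real" where
  "pmf_entropy p = shannon_entropy (measure_pmf p) (\<lambda>x. x)"

lemma shannon_entropy_simple:
  assumes "prob_space M" and "simple_function M X"
  shows "shannon_entropy M X =
    - (\<Sum>a\<in>X ` space M. measure M (X -` {a} \<inter> space M) * log 2 (measure M (X -` {a} \<inter> space M)))"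
proof -
  interpret prob_space M by fact
  interpret information_space M 2 by unfold_locales simp
  show ?thesis
    unfolding shannon_entropy_def
    by (rule entropy_simple_distributed, rule simple_distributedI[OF assms(2)]) auto
qed

lemma pmf_entropy_eq:
  fixes p :: "'x::finite pmf"
  shows "pmf_entropy p = - (\<Sum>x\<in>UNIV. pmf p x * log 2 (pmf p x))"
proof -
  have "simple_function (measure_pmf p) (\<lambda>x::'x. x)"
    by (simp add: simple_function_def)
  then show ?thesis
    by (simp add: pmf_entropy_def shannon_entropy_simple measure_pmf.prob_space_axioms
        vimage_def pmf.rep_eq)
qed

section \<open>The source-coding side\<close>

text \<open>
  A process is given by its law, a probability measure on the sequence space; \<open>X_t\<close> is a
  coordinate, and \<open>hist n\<close> is the random word \<open>X^n\<close>.
\<close>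

definition hist :: "nat \<Rightarrow> (nat \<Rightarrow> 'x) \<Rightarrow> 'x list" where
  "hist n \<omega> = map \<omega> [0..<n]"

definition process_law :: "(nat \<Rightarrow> 'x) measure \<Rightarrow> bool" where
  "process_law P \<longleftrightarrow>
     prob_space P \<and> sets P = sets (PiM UNIV (\<lambda>_. count_space UNIV))"

definition admissible_pairs ::
  "('x \<Rightarrow> real) \<Rightarrow> real \<Rightarrow> real set \<Rightarrow> ((nat \<Rightarrow> 'x) measure \<times> ('x list \<Rightarrow> real)) set" where
  "admissible_pairs \<phi> B E =
     {(P, e). process_law P \<and> (\<forall>xs. e xs \<in> E) \<and>
        (AE \<omega> in P. (\<omega>, \<lambda>t. e (hist t \<omega>)) \<in> feasible_seqs \<phi> B E)}"

definition J_X :: "('x \<Rightarrow> real) \<Rightarrow> real \<Rightarrow> real set \<Rightarrow> real \<Rightarrow> ereal" where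
  "J_X \<phi> B E \<rho> =
     (SUP (P, e) \<in> admissible_pairs \<phi> B E.
        liminf (\<lambda>n. ereal (1 / real n *
          (shannon_entropy P (hist n) - \<rho> * (\<Sum>t<n. \<integral>\<omega>. e (hist t \<omega>) \<partial>P)))))"

section \<open>Markov decision processes with disturbances\<close>

text \<open>
  An MDP has states \<open>S\<close>, initial state \<open>s0\<close>, action sets \<open>U s\<close>, dynamics \<open>f s u w\<close>, disturbance
  law \<open>Q u\<close> and reward \<open>g u\<close>. A policy maps the history of disturbances to an action.
\<close>

primrec mdp_state ::
  "('s \<Rightarrow> 'u \<Rightarrow> 'w \<Rightarrow> 's) \<Rightarrow> 's \<Rightarrow> ('w list \<Rightarrow> 'u) \<Rightarrow> 'w list \<Rightarrow> nat \<Rightarrow> 's" where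
  "mdp_state f s0 \<mu> ws 0 = s0"
| "mdp_state f s0 \<mu> ws (Suc t) = f (mdp_state f s0 \<mu> ws t) (\<mu> (take t ws)) (ws ! t)"

text \<open>
  The action constraint is imposed at every history along which the state has stayed in the
  state space. At other histories \<open>U\<close> has no meaning (it would be empty at a negative battery
  level); they have probability 0 under a policy in this set whenever \<open>Q u\<close> with \<open>u \<in> U s\<close>
  leads from \<open>s \<in> S\<close> into \<open>S\<close>.
\<close>

definition mdp_policies ::
  "'s set \<Rightarrow> 's \<Rightarrow> ('s \<Rightarrow> 'u set) \<Rightarrow> ('s \<Rightarrow> 'u \<Rightarrow> 'w \<Rightarrow> 's) \<Rightarrow> ('w list \<Rightarrow> 'u) set" where
  "mdp_policies S s0 U f =
     {\<mu>. \<forall>ws. (\<forall>t\<le>length ws. mdp_state f s0 \<mu> ws t \<in> S) \<longrightarrow>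
        \<mu> ws \<in> U (mdp_state f s0 \<mu> ws (length ws))}"

primrec mdp_history :: "('u \<Rightarrow> 'w pmf) \<Rightarrow> ('w list \<Rightarrow> 'u) \<Rightarrow> nat \<Rightarrow> 'w list pmf" where
  "mdp_history Q \<mu> 0 = return_pmf []"
| "mdp_history Q \<mu> (Suc n) =
     bind_pmf (mdp_history Q \<mu> n) (\<lambda>ws. map_pmf (\<lambda>w. ws @ [w]) (Q (\<mu> ws)))"

definition mdp_average_reward ::
  "('u \<Rightarrow> 'w pmf) \<Rightarrow> ('u \<Rightarrow> real) \<Rightarrow> ('w list \<Rightarrow> 'u) \<Rightarrow> ereal" where
  "mdp_average_reward Q g \<mu> =
     liminf (\<lambda>n. ereal (1 / real n *
       (\<Sum>t<n. measure_pmf.expectation (mdp_history Q \<mu> t) (\<lambda>ws. g (\<mu> ws)))))"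

definition mdp_optimal_reward ::
  "'s set \<Rightarrow> 's \<Rightarrow> ('s \<Rightarrow> 'u set) \<Rightarrow> ('u \<Rightarrow> 'w pmf) \<Rightarrow> ('s \<Rightarrow> 'u \<Rightarrow> 'w \<Rightarrow> 's) \<Rightarrow>
     ('u \<Rightarrow> real) \<Rightarrow> ereal" where
  "mdp_optimal_reward S s0 U Q f g =
     (SUP \<mu> \<in> mdp_policies S s0 U f. mdp_average_reward Q g \<mu>)"

definition battery_actions ::
  "('x \<Rightarrow> real) \<Rightarrow> real \<Rightarrow> real set \<Rightarrow> real \<Rightarrow> (real \<times> 'x pmf) set" where
  "battery_actions \<phi> B E b =
     {(e, p). e \<in> E \<and> (AE x in measure_pmf p. \<phi> x \<le> min (b + e) B)}"

end

theory Submission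
  imports Defs
begin

text \<open>
  A pair \<open>(P, e)\<close> and a policy \<open>\<mu>\<close> are matched through \<open>\<mu> ws = (e ws, P(X_t | hist = ws))\<close>, so that
  the histories \<open>X^n\<close> have the same law on both sides. By the chain rule \<open>H(X^n)\<close> is the sum of the
  expected entropies of the conditional laws, hence the two rewards agree for every \<open>n\<close>, not only
  in the limit. The battery level is a function of the history, which makes the two feasibility
  constraints the same along histories of positive probability.
\<close>

section \<open>Battery levels and histories\<close>

lemma battery_cong:
  assumes "\<And>s. s < t \<Longrightarrow> x s = x' s" and "\<And>s. s < t \<Longrightarrow> e s = e' s"
  shows "battery \<phi> B x e t = battery \<phi> B x' e' t"
  using assms by (induction t) auto

text \<open>Words and infinite sequences are both read as functions of time, so that one predicate
  with an explicit horizon serves the finite and the infinite constraint.\<close>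

definition feasible_upto ::
  "('x \<Rightarrow> real) \<Rightarrow> real \<Rightarrow> real set \<Rightarrow> (nat \<Rightarrow> 'x) \<Rightarrow> (nat \<Rightarrow> real) \<Rightarrow> nat \<Rightarrow> bool" where
  "feasible_upto \<phi> B E x e n \<longleftrightarrow>
     (\<forall>t<n. e t \<in> E \<and> \<phi> (x t) \<le> min (battery \<phi> B x e t + e t) B)"

lemma feasible_upto_cong:
  assumes "\<And>s. s < n \<Longrightarrow> x s = x' s" and "\<And>s. s < n \<Longrightarrow> e s = e' s"
  shows "feasible_upto \<phi> B E x e n \<longleftrightarrow> feasible_upto \<phi> B E x' e' n"
proof -
  have "battery \<phi> B x e t = battery \<phi> B x' e' t" if "t < n" for t
    by (rule battery_cong) (use that assms in auto)
  then show ?thesis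
    unfolding feasible_upto_def using assms by auto
qed

lemma feasible_words_iff:
  "(xs, es) \<in> feasible_words \<phi> B E n \<longleftrightarrow>
     length xs = n \<and> length es = n \<and> feasible_upto \<phi> B E (nth xs) (nth es) n"
  unfolding feasible_words_def feasible_upto_def by (fastforce simp: in_set_conv_nth)

lemma feasible_words_map_iff:
  "(map x [0..<n], map e [0..<n]) \<in> feasible_words \<phi> B E n \<longleftrightarrow> feasible_upto \<phi> B E x e n"
proof -
  have "feasible_upto \<phi> B E (nth (map x [0..<n])) (nth (map e [0..<n])) n \<longleftrightarrow>
      feasible_upto \<phi> B E x e n"
    by (rule feasible_upto_cong) auto
  then show ?thesis
    by (simp add: feasible_words_iff)
qed

lemma feasible_seqs_iff:
  "(x, e) \<in> feasible_seqs \<phi> B E \<longleftrightarrow> (\<forall>n. feasible_upto \<phi> B E x e n)"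
proof -
  have "(\<forall>n\<ge>1. feasible_upto \<phi> B E x e n) \<longleftrightarrow> (\<forall>n. feasible_upto \<phi> B E x e n)"
    by (metis One_nat_def Suc_leI feasible_upto_def not_gr_zero not_less_zero)
  then show ?thesis
    by (simp add: feasible_seqs_def feasible_words_map_iff)
qed

text \<open>Policies are constrained only while the state stays in the state space; this fact makes
  the constraint available along feasible histories.\<close>

lemma battery_in_reachable:
  assumes "feasible_upto \<phi> B E x e n"
  shows "battery \<phi> B x e n \<in> reachable \<phi> B E"
proof -
  have "battery \<phi> B x e n = battery \<phi> B (nth (map x [0..<n])) (nth (map e [0..<n])) n"
    by (rule battery_cong) auto
  moreover have "(map x [0..<n], map e [0..<n]) \<in> feasible_words \<phi> B E n"
    using assms by (simp add: feasible_words_map_iff)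
  ultimately show ?thesis
    unfolding reachable_def by blast
qed

text \<open>The last feasibility inequality says that the last symbol was paid for, so the remainder
  is nonnegative. This keeps a zero-energy symbol affordable in every state.\<close>

lemma reachable_nonneg:
  assumes "b \<in> reachable \<phi> B E" and "0 \<le> B"
  shows "0 \<le> b"
proof -
  obtain xs es n where b: "b = battery \<phi> B (nth xs) (nth es) n"
    and f: "(xs, es) \<in> feasible_words \<phi> B E n"
    using assms(1) unfolding reachable_def by blast
  show ?thesis
  proof (cases n)
    case 0
    then show ?thesis using b assms(2) by simp
  next
    case (Suc m)
    then show ?thesis
      using b f by (auto simp: feasible_words_def battery_step_def)
  qed
qed

lemma mdp_state_battery:
  "mdp_state (\<lambda>b (e, p) x. battery_step \<phi> B b e x) B \<mu> ws t =
     battery \<phi> B (nth ws) (\<lambda>s. fst (\<mu> (take s ws))) t"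
  by (induction t) (auto split: prod.split)

text \<open>The level at time \<open>s\<close> depends only on the first \<open>s\<close> symbols.
  This carries the constraint on a policy, stated at a prefix, over to the full word.\<close>

lemma battery_take:
  assumes "s \<le> t"
  shows "battery \<phi> B (nth (take t ws)) (\<lambda>r. e (take r (take t ws))) s =
    battery \<phi> B (nth ws) (\<lambda>r. e (take r ws)) s"
  by (rule battery_cong) (use assms in \<open>auto simp: min_def\<close>)

section \<open>The random words of a process\<close>

lemma length_hist [simp]: "length (hist n \<omega>) = n"
  by (simp add: hist_def)

lemma hist_Suc: "hist (Suc n) \<omega> = hist n \<omega> @ [\<omega> n]"
  by (simp add: hist_def)

lemma take_hist: "t \<le> n \<Longrightarrow> take t (hist n \<omega>) = hist t \<omega>"
  by (simp add: hist_def take_map)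

lemma nth_hist: "t < n \<Longrightarrow> hist n \<omega> ! t = \<omega> t"
  by (simp add: hist_def)

lemma hist_eq_iff: "hist n \<omega> = xs \<longleftrightarrow> length xs = n \<and> (\<forall>t<n. \<omega> t = xs ! t)"
  by (auto simp: list_eq_iff_nth_eq nth_hist)

lemma hist_measurable:
  fixes P :: "(nat \<Rightarrow> 'x::finite) measure"
  assumes "process_law P"
  shows "hist n \<in> measurable P (count_space UNIV)"
proof -
  have s: "sets P = sets (PiM UNIV (\<lambda>_. count_space UNIV))"
    using assms by (simp add: process_law_def)
  have coord: "(\<lambda>\<omega>. \<omega> t) \<in> measurable P (count_space UNIV)" for t
    unfolding measurable_cong_sets[OF s refl] by (rule measurable_component_singleton) simp
  show ?thesis
  proof (induction n)
    case 0
    then show ?case by (simp add: hist_def)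
  next
    case (Suc n)
    \<comment> \<open>There are countably many words, so it suffices that appending the next
      coordinate to each fixed word is measurable.\<close>
    have "(\<lambda>\<omega>. (\<lambda>ws \<omega>. ws @ [\<omega> n]) (hist n \<omega>) \<omega>) \<in> measurable P (count_space UNIV)"
      by (rule measurable_compose_countable[OF measurable_compose[OF coord] Suc]) simp
    then show ?case by (simp add: hist_Suc[abs_def])
  qed
qed

lemma process_law_space:
  assumes "process_law P"
  shows "space P = UNIV"
  using sets_eq_imp_space_eq[of P "PiM UNIV (\<lambda>_. count_space UNIV)"] assms
  by (simp add: process_law_def space_PiM)

section \<open>The law of the history and the chain rule\<close>

text \<open>In the mixture over histories, \<open>ws\<close> is the only one that one more symbol
  can turn into \<open>ws @ [x]\<close>.\<close>

lemma pmf_mdp_history_snoc: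
  "pmf (mdp_history Q \<mu> (Suc n)) (ws @ [x]) = pmf (mdp_history Q \<mu> n) ws * pmf (Q (\<mu> ws)) x"
proof -
  have "pmf (map_pmf (\<lambda>w. vs @ [w]) (Q (\<mu> vs))) (ws @ [x]) =
      pmf (Q (\<mu> ws)) x * indicator {ws} vs" for vs
  proof (cases "vs = ws")
    case True
    have "inj (\<lambda>w. ws @ [w])" by (auto intro: injI)
    then show ?thesis using True pmf_map_inj'[of "\<lambda>w. ws @ [w]" "Q (\<mu> ws)" x] by simp
  next
    case False
    then have "ws @ [x] \<notin> set_pmf (map_pmf (\<lambda>w. vs @ [w]) (Q (\<mu> vs)))" by auto
    then have "pmf (map_pmf (\<lambda>w. vs @ [w]) (Q (\<mu> vs))) (ws @ [x]) = 0"
      by (simp only: set_pmf_iff not_not)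
    then show ?thesis using False by simp
  qed
  then show ?thesis
    by (simp add: pmf_bind measure_pmf_single)
qed

lemma set_pmf_mdp_history_length: "ws \<in> set_pmf (mdp_history Q \<mu> n) \<Longrightarrow> length ws = n"
  by (induction n arbitrary: ws) auto

lemma pmf_mdp_history:
  "pmf (mdp_history Q \<mu> n) xs =
     (if length xs = n then \<Prod>t<n. pmf (Q (\<mu> (take t xs))) (xs ! t) else 0)"
proof (cases "length xs = n")
  case True
  then show ?thesis
  proof (induction n arbitrary: xs)
    case 0
    then show ?case by simp
  next
    case (Suc n)
    then obtain ws x where xs: "xs = ws @ [x]" and ws: "length ws = n"
      by (metis length_Suc_conv_rev)
    show ?case
      unfolding xs pmf_mdp_history_snoc Suc.IH[OF ws]
      using ws by (auto simp: nth_append intro!: prod.cong)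
  qed
next
  case False
  then show ?thesis
    using set_pmf_mdp_history_length[of xs Q \<mu> n] by (auto simp: set_pmf_iff)
qed

text \<open>A nonzero product has no zero factor.\<close>

lemma set_pmf_mdp_history_nth:
  assumes "ws \<in> set_pmf (mdp_history Q \<mu> n)" and "t < n"
  shows "ws ! t \<in> set_pmf (Q (\<mu> (take t ws)))"
  using assms by (auto simp: set_pmf_iff pmf_mdp_history split: if_splits)

lemma finite_lists_of_length: "finite {xs :: 'x::finite list. length xs = n}"
  using finite_lists_length_eq[of "UNIV :: 'x set" n] by simp

lemma expectation_mdp_history:
  fixes h :: "'x::finite list \<Rightarrow> real"
  shows "measure_pmf.expectation (mdp_history Q \<mu> n) h =
    (\<Sum>ws | length ws = n. pmf (mdp_history Q \<mu> n) ws * h ws)"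
  using set_pmf_mdp_history_length
  by (subst integral_measure_pmf[OF finite_lists_of_length]) auto

lemma sum_lists_Suc:
  "(\<Sum>ws :: 'x::finite list | length ws = Suc n. h ws) = (\<Sum>ws | length ws = n. \<Sum>x\<in>UNIV. h (ws @ [x]))"
proof -
  have "{ws :: 'x list. length ws = Suc n} = (\<lambda>(ws, x). ws @ [x]) ` ({ws. length ws = n} \<times> UNIV)"
    by (auto simp: image_iff length_Suc_conv_rev)
  moreover have "inj_on (\<lambda>(ws, x). ws @ [x]) ({ws :: 'x list. length ws = n} \<times> UNIV)"
    by (auto intro: inj_onI)
  ultimately show ?thesis
    by (simp add: sum.reindex sum.cartesian_product case_prod_unfold)
qed

text \<open>The logarithm of \<open>pmf_mdp_history_snoc\<close> splits into a part for the history
  and a part for the new symbol. Summing over the symbol first leaves the old entropy plus the mean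
  entropy of the next conditional law.\<close>

lemma mdp_history_chain_rule:
  fixes Q :: "'u \<Rightarrow> 'x::finite pmf"
  shows "- (\<Sum>ws | length ws = n. pmf (mdp_history Q \<mu> n) ws * log 2 (pmf (mdp_history Q \<mu> n) ws)) =
    (\<Sum>t<n. measure_pmf.expectation (mdp_history Q \<mu> t) (\<lambda>ws. pmf_entropy (Q (\<mu> ws))))"
proof (induction n)
  case 0
  then show ?case by simp
next
  case (Suc n)
  let ?h = "pmf (mdp_history Q \<mu> n)"
  have "(\<Sum>x\<in>UNIV. pmf (mdp_history Q \<mu> (Suc n)) (ws @ [x]) *
        log 2 (pmf (mdp_history Q \<mu> (Suc n)) (ws @ [x]))) =
      ?h ws * log 2 (?h ws) - ?h ws * pmf_entropy (Q (\<mu> ws))" for ws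
  proof -
    \<comment> \<open>Splitting the logarithm requires positive factors; when one of them is 0, both
      sides vanish, in line with the convention 0 log 0 = 0.\<close>
    have "?h ws * pmf (Q (\<mu> ws)) x * log 2 (?h ws * pmf (Q (\<mu> ws)) x) =
        ?h ws * log 2 (?h ws) * pmf (Q (\<mu> ws)) x +
        ?h ws * (pmf (Q (\<mu> ws)) x * log 2 (pmf (Q (\<mu> ws)) x))" for x
    proof (cases "?h ws = 0 \<or> pmf (Q (\<mu> ws)) x = 0")
      case False
      then have "0 < ?h ws" "0 < pmf (Q (\<mu> ws)) x"
        by (simp_all add: pmf_pos)
      then show ?thesis by (simp add: log_mult algebra_simps)
    qed auto
    then have "(\<Sum>x\<in>UNIV. pmf (mdp_history Q \<mu> (Suc n)) (ws @ [x]) *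
        log 2 (pmf (mdp_history Q \<mu> (Suc n)) (ws @ [x]))) =
      ?h ws * log 2 (?h ws) * (\<Sum>x\<in>UNIV. pmf (Q (\<mu> ws)) x) +
      ?h ws * (\<Sum>x\<in>UNIV. pmf (Q (\<mu> ws)) x * log 2 (pmf (Q (\<mu> ws)) x))"
      unfolding pmf_mdp_history_snoc by (simp add: sum.distrib sum_distrib_left)
    moreover have "(\<Sum>x\<in>UNIV. pmf (Q (\<mu> ws)) x) = 1"
      by (rule sum_pmf_eq_1) auto
    ultimately show ?thesis by (simp add: pmf_entropy_eq)
  qed
  then show ?case
    using Suc.IH by (simp only: sum_lists_Suc) (simp add: sum_subtractf expectation_mdp_history)
qed

section \<open>Equality of the two rewards at every finite horizon\<close>

lemma shannon_entropy_hist: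
  fixes P :: "(nat \<Rightarrow> 'x::finite) measure"
  assumes "process_law P"
    and law: "distr P (count_space UNIV) (hist n) = measure_pmf p"
  shows "shannon_entropy P (hist n) = - (\<Sum>ws | length ws = n. pmf p ws * log 2 (pmf p ws))"
proof -
  have img: "hist n ` space P = {ws. length ws = n}"
  proof -
    \<comment> \<open>The function \<open>nth ws\<close> serves as a sequence that starts with
      \<open>ws\<close>; its values beyond the word are irrelevant.\<close>
    have "ws \<in> range (hist n)" if "length ws = n" for ws :: "'x list"
      using that by (intro image_eqI[where x = "nth ws"]) (auto simp: hist_def map_nth)
    then show ?thesis by (auto simp: process_law_space[OF assms(1)])
  qed
  have "simple_function P (hist n)"
    unfolding simple_function_def img
    using finite_lists_of_length measurable_sets[OF hist_measurable[OF assms(1)]] by auto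
  moreover have "measure P (hist n -` {ws} \<inter> space P) = pmf p ws" for ws
    using measure_distr[OF hist_measurable[OF assms(1)], of "{ws}" n] law
    by (simp add: measure_pmf_single)
  ultimately show ?thesis
    using assms(1) by (simp add: shannon_entropy_simple process_law_def img)
qed

text \<open>Both directions of the theorem end here. Agreement of \<open>e\<close> with the policy
  is asked for only on histories of positive probability, because \<open>process_of_policy\<close>
  changes the charging function elsewhere.\<close>

lemma process_reward_eq_mdp_reward:
  fixes \<mu> :: "'x::finite list \<Rightarrow> real \<times> 'x pmf"
  assumes "process_law P"
    and law: "\<And>n. distr P (count_space UNIV) (hist n) = measure_pmf (mdp_history snd \<mu> n)"
    and e: "\<And>n ws. ws \<in> set_pmf (mdp_history snd \<mu> n) \<Longrightarrow> e ws = fst (\<mu> ws)"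
  shows "shannon_entropy P (hist n) - \<rho> * (\<Sum>t<n. \<integral>\<omega>. e (hist t \<omega>) \<partial>P) =
    (\<Sum>t<n. measure_pmf.expectation (mdp_history snd \<mu> t)
      (\<lambda>ws. (\<lambda>(e, p). pmf_entropy p - \<rho> * e) (\<mu> ws)))"
proof -
  have 1: "(\<integral>\<omega>. e (hist t \<omega>) \<partial>P) = measure_pmf.expectation (mdp_history snd \<mu> t) (\<lambda>ws. fst (\<mu> ws))"
    for t
  proof -
    have "(\<integral>\<omega>. e (hist t \<omega>) \<partial>P) = measure_pmf.expectation (mdp_history snd \<mu> t) e"
      unfolding law[symmetric] by (rule integral_distr[symmetric]) (auto intro: hist_measurable assms)
    also have "\<dots> = measure_pmf.expectation (mdp_history snd \<mu> t) (\<lambda>ws. fst (\<mu> ws))"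
      using e by (intro integral_cong_AE) (auto simp: AE_measure_pmf_iff)
    finally show ?thesis .
  qed
  have "shannon_entropy P (hist n) =
      (\<Sum>t<n. measure_pmf.expectation (mdp_history snd \<mu> t) (\<lambda>ws. pmf_entropy (snd (\<mu> ws))))"
    by (rule trans[OF shannon_entropy_hist[OF assms(1) law] mdp_history_chain_rule])
  moreover have "measure_pmf.expectation (mdp_history snd \<mu> t)
        (\<lambda>ws. (\<lambda>(e, p). pmf_entropy p - \<rho> * e) (\<mu> ws)) =
      measure_pmf.expectation (mdp_history snd \<mu> t) (\<lambda>ws. pmf_entropy (snd (\<mu> ws))) -
      \<rho> * measure_pmf.expectation (mdp_history snd \<mu> t) (\<lambda>ws. fst (\<mu> ws))" for t
    unfolding expectation_mdp_history sum_distrib_left sum_subtractf[symmetric]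
    by (rule sum.cong) (simp_all add: case_prod_unfold right_diff_distrib)
  ultimately show ?thesis
    by (simp only: 1 sum_subtractf sum_distrib_left)
qed

section \<open>From processes to policies\<close>

text \<open>The one-symbol extensions of a word partition its cylinder.\<close>

lemma sum_prob_hist_snoc:
  fixes P :: "(nat \<Rightarrow> 'x::finite) measure"
  assumes "process_law P"
  shows "(\<Sum>x\<in>UNIV. measure P (hist (Suc n) -` {ws @ [x]})) = measure P (hist n -` {ws})"
proof -
  interpret prob_space P using assms by (simp add: process_law_def)
  have "hist (Suc n) -` {vs} \<in> sets P" for vs :: "'x list"
    using measurable_sets[OF hist_measurable[OF assms], of "{vs}"]
    by (simp add: process_law_space[OF assms])
  then have "measure P (\<Union>x. hist (Suc n) -` {ws @ [x]}) =
      (\<Sum>x\<in>UNIV. measure P (hist (Suc n) -` {ws @ [x]}))"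
    by (intro finite_measure_finite_Union) (auto simp: disjoint_family_on_def)
  moreover have "(\<Union>x. hist (Suc n) -` {ws @ [x]}) = hist n -` {ws}"
    by (auto simp: hist_Suc)
  ultimately show ?thesis by simp
qed

text \<open>The policy keeps the charging function and uses ratios of cylinder probabilities as
  conditional laws. Its constraint at a history of positive probability is read off from a single
  feasible sample path through that history.\<close>

lemma policy_of_process:
  fixes \<phi> :: "'x::finite \<Rightarrow> real"
  assumes "E \<subseteq> {0..B}" and "0 \<le> B" and "\<phi> x0 = 0"
    and adm: "(P, e) \<in> admissible_pairs \<phi> B E"
  obtains \<mu> where
    "\<mu> \<in> mdp_policies (reachable \<phi> B E) B (battery_actions \<phi> B E)
      (\<lambda>b (e, p) x. battery_step \<phi> B b e x)"
    and "\<And>n. distr P (count_space UNIV) (hist n) = measure_pmf (mdp_history snd \<mu> n)"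
    and "\<And>ws. e ws = fst (\<mu> ws)"
proof -
  have P: "process_law P" and eE: "\<And>xs. e xs \<in> E"
    and feas: "AE \<omega> in P. (\<omega>, \<lambda>t. e (hist t \<omega>)) \<in> feasible_seqs \<phi> B E"
    using adm by (auto simp: admissible_pairs_def)
  interpret prob_space P using P by (simp add: process_law_def)
  define m where "m ws = measure P (hist (length ws) -` {ws})" for ws
  have m_nonneg: "0 \<le> m ws" for ws by (simp add: m_def)
  have m_sum: "(\<Sum>x\<in>UNIV. m (ws @ [x])) = m ws" for ws
    unfolding m_def using sum_prob_hist_snoc[OF P, of "length ws" ws] by simp
  \<comment> \<open>Policies are also constrained at histories of probability 0; there the zero-energy symbol is
    sent.\<close>
  define q where "q ws = (if m ws = 0 then return_pmf x0 else embed_pmf (\<lambda>x. m (ws @ [x]) / m ws))"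
    for ws
  have q: "pmf (q ws) x = m (ws @ [x]) / m ws" if "m ws \<noteq> 0" for ws x
  proof -
    \<comment> \<open>Total mass 1 is what \<open>embed_pmf\<close> requires in order to have the
      prescribed weights.\<close>
    have "(\<integral>\<^sup>+x. ennreal (m (ws @ [x]) / m ws) \<partial>count_space UNIV) = 1"
      using that m_nonneg
      by (simp add: nn_integral_count_space_finite sum_divide_distrib[symmetric] m_sum)
    then show ?thesis
      using that m_nonneg by (simp add: q_def pmf_embed_pmf)
  qed
  \<comment> \<open>The product rule survives at null histories, whatever \<open>q\<close> is there:
    nonnegative masses that sum to 0 all vanish.\<close>
  have m_step: "m (ws @ [x]) = m ws * pmf (q ws) x" for ws x
  proof (cases "m ws = 0")
    case True
    then have "\<forall>x\<in>UNIV. m (ws @ [x]) = 0"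
      using m_sum[of ws] m_nonneg by (subst sum_nonneg_eq_0_iff[symmetric]) auto
    then show ?thesis using True by simp
  qed (simp add: q)
  define \<mu> where "\<mu> ws = (e ws, q ws)" for ws
  have m_eq: "m ws = pmf (mdp_history snd \<mu> (length ws)) ws" for ws
  proof (induction ws rule: rev_induct)
    case Nil
    have "hist 0 -` {[]} = space P"
      by (auto simp: hist_def process_law_space[OF P])
    then show ?case by (simp add: m_def prob_space)
  next
    case (snoc x ws)
    then show ?case
      by (simp add: m_step pmf_mdp_history_snoc \<mu>_def del: mdp_history.simps)
  qed
  have pt: "measure P (hist n -` {ws}) = pmf (mdp_history snd \<mu> n) ws" for n ws
  proof (cases "length ws = n")
    case True
    then show ?thesis using m_eq[of ws] by (simp add: m_def)
  next
    case False
    then have "hist n -` {ws} = {}" by auto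
    with False show ?thesis by (simp add: pmf_mdp_history)
  qed
  have law: "distr P (count_space UNIV) (hist n) = measure_pmf (mdp_history snd \<mu> n)" for n
  proof (rule measure_eqI_countable[of _ UNIV])
    fix ws :: "'x list"
    have "emeasure (distr P (count_space UNIV) (hist n)) {ws} = measure P (hist n -` {ws})"
      by (simp add: emeasure_distr hist_measurable[OF P] process_law_space[OF P] emeasure_eq_measure)
    then show "emeasure (distr P (count_space UNIV) (hist n)) {ws} =
        emeasure (measure_pmf (mdp_history snd \<mu> n)) {ws}"
      by (simp add: pt emeasure_pmf_single)
  qed auto
  have "\<mu> \<in> mdp_policies (reachable \<phi> B E) B (battery_actions \<phi> B E)
      (\<lambda>b (e, p) x. battery_step \<phi> B b e x)"
    unfolding mdp_policies_def mdp_state_battery mem_Collect_eq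
  proof (intro allI impI)
    fix ws
    let ?b = "battery \<phi> B (nth ws) (\<lambda>s. fst (\<mu> (take s ws))) (length ws)"
    assume "\<forall>t\<le>length ws. battery \<phi> B (nth ws) (\<lambda>s. fst (\<mu> (take s ws))) t \<in> reachable \<phi> B E"
    then have b: "0 \<le> ?b" using reachable_nonneg assms(2) by blast
    have "\<phi> x \<le> min (?b + e ws) B" if "x \<in> set_pmf (q ws)" for x
    proof (cases "m ws = 0")
      case True
      then have "x = x0" using that by (simp add: q_def)
      then show ?thesis using b eE[of ws] assms(1-3) by auto
    next
      case False
      then have "m (ws @ [x]) \<noteq> 0" using that by (simp add: m_step set_pmf_iff)
      \<comment> \<open>A cylinder of positive probability must meet the set of feasible paths,
        which has full measure.\<close>
      then have "\<exists>\<omega>. (\<omega>, \<lambda>t. e (hist t \<omega>)) \<in> feasible_seqs \<phi> B E \<and>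
          hist (Suc (length ws)) \<omega> = ws @ [x]"
      proof (rule contrapos_np)
        assume "\<not> ?thesis"
        then have "AE \<omega> in P. \<omega> \<notin> hist (length (ws @ [x])) -` {ws @ [x]}"
          using feas by (auto elim!: eventually_mono)
        then show "m (ws @ [x]) = 0"
          unfolding m_def
          using measurable_sets[OF hist_measurable[OF P], of "{ws @ [x]}" "length (ws @ [x])"]
          by (subst prob_eq_0) (auto simp: process_law_space[OF P])
      qed
      then obtain \<omega> where \<omega>: "\<forall>n. feasible_upto \<phi> B E \<omega> (\<lambda>t. e (hist t \<omega>)) n"
        and ws: "ws = hist (length ws) \<omega>" and x: "x = \<omega> (length ws)"
        by (fastforce simp: feasible_seqs_iff hist_Suc)
      have "?b = battery \<phi> B \<omega> (\<lambda>t. e (hist t \<omega>)) (length ws)"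
        by (rule battery_cong; subst ws) (simp_all add: \<mu>_def nth_hist take_hist)
      moreover have "e (hist (length ws) \<omega>) = e ws"
        using ws by simp
      ultimately show ?thesis
        \<comment> \<open>Horizon \<open>length ws + 1\<close> is the first one whose inequalities
          include the one for \<open>x\<close>, sent right after \<open>ws\<close>.\<close>
        using \<omega>[rule_format, of "Suc (length ws)"] x by (auto simp: feasible_upto_def less_Suc_eq)
    qed
    then show "\<mu> ws \<in> battery_actions \<phi> B E ?b"
      using eE by (simp add: battery_actions_def \<mu>_def AE_measure_pmf_iff)
  qed
  then show ?thesis using that law by (simp add: \<mu>_def)
qed

section \<open>From policies to processes\<close>

text \<open>Here \<open>y\<close> is a table listing the next symbol for every possible past, and
  \<open>trace\<close> is the word obtained by following the table from the empty past.\<close>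

primrec trace :: "('x list \<Rightarrow> 'x) \<Rightarrow> nat \<Rightarrow> 'x list" where
  "trace y 0 = []"
| "trace y (Suc n) = trace y n @ [y (trace y n)]"

lemma length_trace [simp]: "length (trace y n) = n"
  by (induction n) auto

lemma hist_trace: "hist n (\<lambda>t. y (trace y t)) = trace y n"
  by (induction n) (auto simp: hist_Suc hist_def)

text \<open>The event that the path spells \<open>xs\<close> restricts \<open>y\<close> only at the
  proper prefixes of \<open>xs\<close>. The cylinder thus becomes a finite rectangle in the product
  space.\<close>

lemma trace_eq_iff: "trace y n = xs \<longleftrightarrow> length xs = n \<and> (\<forall>t<n. y (take t xs) = xs ! t)"
proof (induction n arbitrary: xs)
  case 0
  then show ?case by auto
next
  case (Suc n)
  show ?case
  proof (cases "length xs = Suc n")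
    case True
    then obtain ws x where "xs = ws @ [x]" and "length ws = n"
      by (metis length_Suc_conv_rev)
    then show ?thesis
      using Suc.IH[of ws] by (auto simp: nth_append less_Suc_eq)
  next
    case False
    then show ?thesis using length_trace[of y "Suc n"] by metis
  qed
qed

text \<open>Draw one symbol for every finite word, all independently, and let the process read off the
  symbol attached to its own past; no extension theorem beyond product measures is needed.\<close>

lemma process_of_kernel:
  fixes q :: "'x::finite list \<Rightarrow> 'x pmf"
  obtains P :: "(nat \<Rightarrow> 'x) measure" where "process_law P"
    and "\<And>n xs. length xs = n \<Longrightarrow>
      emeasure P (hist n -` {xs}) = ennreal (\<Prod>t<n. pmf (q (take t xs)) (xs ! t))"
proof -
  define M where "M = PiM (UNIV :: 'x list set) (\<lambda>ws. measure_pmf (q ws))"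
  let ?N = "PiM (UNIV :: nat set) (\<lambda>_. count_space (UNIV :: 'x set))"
  let ?X = "\<lambda>(y :: 'x list \<Rightarrow> 'x) t. y (trace y t)"
  interpret product_prob_space "\<lambda>ws. measure_pmf (q ws)" "UNIV :: 'x list set"
    by unfold_locales
  have space_M: "space M = UNIV" by (simp add: M_def space_PiM)
  have coord: "(\<lambda>y. y ws) \<in> measurable M (count_space UNIV)" for ws
    unfolding M_def using measurable_component_singleton[of ws UNIV "\<lambda>ws. measure_pmf (q ws)"] by simp
  have trace: "(\<lambda>y. trace y n) \<in> measurable M (count_space UNIV)" for n
  proof (induction n)
    case 0
    then show ?case by simp
  next
    case (Suc n)
    have "(\<lambda>y. (\<lambda>ws y. ws @ [y ws]) (trace y n) y) \<in> measurable M (count_space UNIV)"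
      by (rule measurable_compose_countable[OF measurable_compose[OF coord] Suc]) simp
    then show ?case by simp
  qed
  \<comment> \<open>The coordinate of \<open>y\<close> that is read is itself random, but it ranges
    over countably many words.\<close>
  have X: "?X \<in> measurable M ?N"
    by (rule measurable_PiM_single')
      (use measurable_compose_countable[OF coord trace] in \<open>auto simp: space_M\<close>)
  define P where "P = distr M ?N ?X"
  have P: "process_law P"
    unfolding process_law_def P_def
    using prob_space.prob_space_distr[OF _ X] prob_space_axioms by (simp add: M_def)
  have "emeasure P (hist n -` {xs}) = ennreal (\<Prod>t<n. pmf (q (take t xs)) (xs ! t))"
    if len: "length xs = n" for n and xs
  proof -
    let ?J = "(\<lambda>t. take t xs) ` {..<n}"
    \<comment> \<open>Distinct prefixes have distinct lengths, so each factor of the product comes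
      from its own independent coordinate.\<close>
    have inj: "inj_on (\<lambda>t. take t xs) {..<n}"
      using len by (auto intro!: inj_onI dest: arg_cong[where f = length])
    have "hist n -` {xs} \<in> sets ?N"
      using measurable_sets[OF hist_measurable[OF P], of "{xs}" n]
      by (simp add: process_law_space[OF P]) (simp add: P_def)
    then have "emeasure P (hist n -` {xs}) = emeasure M {y. trace y n = xs}"
      unfolding P_def using emeasure_distr[OF X]
      by (simp add: space_M vimage_def hist_trace)
    \<comment> \<open>The time index is recovered as the length of the prefix.\<close>
    also have "{y. trace y n = xs} = {y \<in> space M. \<forall>ws\<in>?J. y ws \<in> {xs ! length ws}}"
      using len by (auto simp: space_M trace_eq_iff)
    also have "emeasure M \<dots> = (\<Prod>ws\<in>?J. emeasure (measure_pmf (q ws)) {xs ! length ws})"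
      unfolding M_def by (rule emeasure_PiM_Collect) auto
    also have "\<dots> = (\<Prod>t<n. ennreal (pmf (q (take t xs)) (xs ! t)))"
      using len by (subst prod.reindex[OF inj]) (auto simp: emeasure_pmf_single intro!: prod.cong)
    also have "\<dots> = ennreal (\<Prod>t<n. pmf (q (take t xs)) (xs ! t))"
      by (rule prod_ennreal) simp
    finally show ?thesis .
  qed
  with P show ?thesis using that by blast
qed

text \<open>The policy is constrained only if all earlier states are reachable, and reachability
  comes from feasibility so far; induction on time resolves this mutual dependence.\<close>

lemma mdp_history_feasible:
  fixes \<mu> :: "'x list \<Rightarrow> real \<times> 'x pmf"
  assumes pol: "\<mu> \<in> mdp_policies (reachable \<phi> B E) B (battery_actions \<phi> B E)
      (\<lambda>b (e, p) x. battery_step \<phi> B b e x)"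
    and ws: "\<And>t. t < n \<Longrightarrow> ws ! t \<in> set_pmf (snd (\<mu> (take t ws)))"
    and len: "length ws = n"
  shows "feasible_upto \<phi> B E (nth ws) (\<lambda>t. fst (\<mu> (take t ws))) n \<and> fst (\<mu> ws) \<in> E"
proof -
  let ?e = "\<lambda>t. fst (\<mu> (take t ws))"
  \<comment> \<open>The case \<open>t = n\<close> is included: it has no symbol yet, but it yields
    that the energy chosen after the whole word lies in \<open>E\<close>.\<close>
  have act: "\<mu> (take t ws) \<in> battery_actions \<phi> B E (battery \<phi> B (nth ws) ?e t)"
    if "feasible_upto \<phi> B E (nth ws) ?e t" and "t \<le> n" for t
  proof -
    have "battery \<phi> B (nth ws) ?e s \<in> reachable \<phi> B E" if "s \<le> t" for s
      using that \<open>feasible_upto \<phi> B E (nth ws) ?e t\<close>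
      by (intro battery_in_reachable) (auto simp: feasible_upto_def)
    then have "\<forall>s\<le>length (take t ws).
        battery \<phi> B (nth (take t ws)) (\<lambda>r. fst (\<mu> (take r (take t ws)))) s \<in> reachable \<phi> B E"
      using battery_take[where e = "\<lambda>ws. fst (\<mu> ws)"] by auto
    then have "\<mu> (take t ws) \<in> battery_actions \<phi> B E
        (battery \<phi> B (nth (take t ws)) (\<lambda>r. fst (\<mu> (take r (take t ws)))) (length (take t ws)))"
      using pol unfolding mdp_policies_def mdp_state_battery by blast
    then show ?thesis
      using battery_take[of t t \<phi> B ws "\<lambda>ws. fst (\<mu> ws)"] that len by (simp add: min_absorb2)
  qed
  have "feasible_upto \<phi> B E (nth ws) ?e t" if "t \<le> n" for t
    using that
  proof (induction t)
    case 0
    then show ?case by (simp add: feasible_upto_def)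
  next
    case (Suc t)
    then have f: "feasible_upto \<phi> B E (nth ws) ?e t" by simp
    show ?case
      using act[OF f] ws[of t] Suc.prems f
      by (auto simp: feasible_upto_def less_Suc_eq battery_actions_def AE_measure_pmf_iff)
  qed
  then have "feasible_upto \<phi> B E (nth ws) ?e n" by simp
  moreover have "fst (\<mu> ws) \<in> E"
    using act[OF calculation] len by (auto simp: battery_actions_def)
  ultimately show ?thesis by simp
qed

text \<open>The process draws each symbol from the law that the policy prescribes for its past.
  Almost surely all its prefixes lie in the supports of the history laws, where
  \<open>mdp_history_feasible\<close> applies.\<close>

lemma process_of_policy:
  fixes \<phi> :: "'x::finite \<Rightarrow> real"
  assumes "E \<noteq> {}"
    and pol: "\<mu> \<in> mdp_policies (reachable \<phi> B E) B (battery_actions \<phi> B E)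
      (\<lambda>b (e, p) x. battery_step \<phi> B b e x)"
  obtains P e where "(P, e) \<in> admissible_pairs \<phi> B E"
    and "\<And>n. distr P (count_space UNIV) (hist n) = measure_pmf (mdp_history snd \<mu> n)"
    and "\<And>n ws. ws \<in> set_pmf (mdp_history snd \<mu> n) \<Longrightarrow> e ws = fst (\<mu> ws)"
proof -
  obtain P :: "(nat \<Rightarrow> 'x) measure" where P: "process_law P"
    and cyl: "\<And>n xs. length xs = n \<Longrightarrow>
      emeasure P (hist n -` {xs}) = ennreal (\<Prod>t<n. pmf (snd (\<mu> (take t xs))) (xs ! t))"
    using process_of_kernel[of "\<lambda>ws. snd (\<mu> ws)"] by blast
  have law: "distr P (count_space UNIV) (hist n) = measure_pmf (mdp_history snd \<mu> n)" for n
  proof (rule measure_eqI_countable[of _ UNIV])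
    fix ws :: "'x list"
    have "emeasure P (hist n -` {ws}) = ennreal (pmf (mdp_history snd \<mu> n) ws)"
    proof (cases "length ws = n")
      case True
      then show ?thesis by (simp add: cyl pmf_mdp_history)
    next
      case False
      then have "hist n -` {ws} = {}" by auto
      with False show ?thesis by (simp add: pmf_mdp_history)
    qed
    then show "emeasure (distr P (count_space UNIV) (hist n)) {ws} =
        emeasure (measure_pmf (mdp_history snd \<mu> n)) {ws}"
      by (simp add: emeasure_distr hist_measurable[OF P] process_law_space[OF P] emeasure_pmf_single)
  qed auto
  obtain e0 where e0: "e0 \<in> E" using assms(1) by blast
  \<comment> \<open>At histories where the state has left the state space the policy is unconstrained, while \<open>e\<close>
    must take values in \<open>E\<close> everywhere.\<close>
  define e where "e ws = (if fst (\<mu> ws) \<in> E then fst (\<mu> ws) else e0)" for ws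
  have supp: "feasible_upto \<phi> B E (nth ws) (\<lambda>t. fst (\<mu> (take t ws))) n \<and> fst (\<mu> ws) \<in> E"
    if "ws \<in> set_pmf (mdp_history snd \<mu> n)" for n ws
    by (rule mdp_history_feasible[OF pol set_pmf_mdp_history_nth[OF that]
          set_pmf_mdp_history_length[OF that]])
  have e: "e ws = fst (\<mu> ws)" if "ws \<in> set_pmf (mdp_history snd \<mu> n)" for n ws
    using supp[OF that] by (simp add: e_def)
  have "AE \<omega> in P. hist n \<omega> \<in> set_pmf (mdp_history snd \<mu> n)" for n
  proof -
    have "AE ws in distr P (count_space UNIV) (hist n). ws \<in> set_pmf (mdp_history snd \<mu> n)"
      unfolding law by (rule AE_measure_pmf)
    then show ?thesis
      by (subst (asm) AE_distr_iff) (auto intro: hist_measurable[OF P])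
  qed
  \<comment> \<open>One null set serves all horizons, being a countable union of null sets.\<close>
  then have "AE \<omega> in P. \<forall>n. hist n \<omega> \<in> set_pmf (mdp_history snd \<mu> n)"
    by (simp add: AE_all_countable)
  then have "AE \<omega> in P. (\<omega>, \<lambda>t. e (hist t \<omega>)) \<in> feasible_seqs \<phi> B E"
  proof (rule eventually_mono)
    fix \<omega>
    assume \<omega>: "\<forall>n. hist n \<omega> \<in> set_pmf (mdp_history snd \<mu> n)"
    have "feasible_upto \<phi> B E \<omega> (\<lambda>t. e (hist t \<omega>)) n" for n
    proof -
      have "feasible_upto \<phi> B E (nth (hist n \<omega>)) (\<lambda>t. fst (\<mu> (take t (hist n \<omega>)))) n \<longleftrightarrow>
          feasible_upto \<phi> B E \<omega> (\<lambda>t. e (hist t \<omega>)) n"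
        \<comment> \<open>Every prefix of the path lies in a support, so \<open>e\<close> and the
          policy choose the same energies along it.\<close>
        by (rule feasible_upto_cong) (simp_all add: nth_hist take_hist e[OF \<omega>[rule_format]])
      then show ?thesis using supp \<omega> by blast
    qed
    then show "(\<omega>, \<lambda>t. e (hist t \<omega>)) \<in> feasible_seqs \<phi> B E"
      by (simp add: feasible_seqs_iff)
  qed
  then have "(P, e) \<in> admissible_pairs \<phi> B E"
    using P e0 by (auto simp: admissible_pairs_def e_def)
  then show ?thesis using that law e by blast
qed

section \<open>The two inequalities between the suprema\<close>

theorem mainTheorem7:
  fixes \<phi> :: "'x::finite \<Rightarrow> real" and B :: real and E :: "real set" and \<rho> :: real
  assumes "finite E"
    and "E \<subseteq> {0..B}"
    and "\<exists>e\<in>E. 0 < e"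
    and "\<And>x. 0 \<le> \<phi> x"
    and "\<And>x. \<phi> x \<le> B"
    and "\<exists>x. \<phi> x = 0"
    and "finite (reachable \<phi> B E)"
    and "0 \<le> \<rho>"
  shows "J_X \<phi> B E \<rho> =
    mdp_optimal_reward (reachable \<phi> B E) B (battery_actions \<phi> B E) snd
      (\<lambda>b (e, p) x. battery_step \<phi> B b e x)
      (\<lambda>(e, p). pmf_entropy p - \<rho> * e)"
proof (rule antisym)
  obtain x0 where x0: "\<phi> x0 = 0" using assms(6) by blast
  have B: "0 \<le> B" using assms(5)[of x0] x0 by simp
  show "J_X \<phi> B E \<rho> \<le> mdp_optimal_reward (reachable \<phi> B E) B (battery_actions \<phi> B E) snd
      (\<lambda>b (e, p) x. battery_step \<phi> B b e x) (\<lambda>(e, p). pmf_entropy p - \<rho> * e)"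
    unfolding J_X_def mdp_optimal_reward_def
  proof (rule SUP_least, clarify)
    fix P e assume "(P, e) \<in> admissible_pairs \<phi> B E"
    from policy_of_process[OF assms(2) B x0 this] obtain \<mu> where
      pol: "\<mu> \<in> mdp_policies (reachable \<phi> B E) B (battery_actions \<phi> B E)
        (\<lambda>b (e, p) x. battery_step \<phi> B b e x)"
      and law: "\<And>n. distr P (count_space UNIV) (hist n) = measure_pmf (mdp_history snd \<mu> n)"
      and e: "\<And>ws. e ws = fst (\<mu> ws)"
      by blast
    have "process_law P"
      using \<open>(P, e) \<in> admissible_pairs \<phi> B E\<close> by (simp add: admissible_pairs_def)
    \<comment> \<open>The two reward sequences coincide for every \<open>n\<close>, hence so do
      their lower limits, and the matched policy witnesses the bound.\<close>
    from process_reward_eq_mdp_reward[OF this law e] show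
      "liminf (\<lambda>n. ereal (1 / real n *
          (shannon_entropy P (hist n) - \<rho> * (\<Sum>t<n. \<integral>\<omega>. e (hist t \<omega>) \<partial>P))))
        \<le> (SUP \<mu>\<in>mdp_policies (reachable \<phi> B E) B (battery_actions \<phi> B E)
              (\<lambda>b (e, p) x. battery_step \<phi> B b e x).
            mdp_average_reward snd (\<lambda>(e, p). pmf_entropy p - \<rho> * e) \<mu>)"
      by (intro SUP_upper2[OF pol]) (simp add: mdp_average_reward_def)
  qed
  show "mdp_optimal_reward (reachable \<phi> B E) B (battery_actions \<phi> B E) snd
      (\<lambda>b (e, p) x. battery_step \<phi> B b e x) (\<lambda>(e, p). pmf_entropy p - \<rho> * e) \<le> J_X \<phi> B E \<rho>"
    unfolding J_X_def mdp_optimal_reward_def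
  proof (rule SUP_least)
    fix \<mu> assume pol: "\<mu> \<in> mdp_policies (reachable \<phi> B E) B (battery_actions \<phi> B E)
        (\<lambda>b (e, p) x. battery_step \<phi> B b e x)"
    have "E \<noteq> {}" using assms(3) by blast
    from process_of_policy[OF this pol] obtain P e where
      adm: "(P, e) \<in> admissible_pairs \<phi> B E"
      and law: "\<And>n. distr P (count_space UNIV) (hist n) = measure_pmf (mdp_history snd \<mu> n)"
      and e: "\<And>n ws. ws \<in> set_pmf (mdp_history snd \<mu> n) \<Longrightarrow> e ws = fst (\<mu> ws)"
      by blast
    have "process_law P" using adm by (simp add: admissible_pairs_def)
    from process_reward_eq_mdp_reward[OF this law e] show
      "mdp_average_reward snd (\<lambda>(e, p). pmf_entropy p - \<rho> * e) \<mu> \<le>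
        (SUP (P, e)\<in>admissible_pairs \<phi> B E. liminf (\<lambda>n. ereal (1 / real n *
          (shannon_entropy P (hist n) - \<rho> * (\<Sum>t<n. \<integral>\<omega>. e (hist t \<omega>) \<partial>P)))))"
      by (intro SUP_upper2[OF adm]) (simp add: mdp_average_reward_def)
  qed
qed

end
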